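(* Consider the problem $\min_{\mathbf{x}\in\mathbb{R}^m}P(\mathbf{x})=f(\mathbf{x})+h(\mathbf{x})$ with $f(\mathbf{x})=\frac1n\sum_{i=1}^n f_i(\mathbf{x})$. Suppose that the cost function satisfies the following conditions: (i) $f$ is strongly convex with constant $\mu$, and $h$ is convex; (ii) $f$ is differentiable and $\nabla f$ is Lipschitz continuous with constant $L$; (iii) $\mathbb{E}\|\nabla f_i(\mathbf{x})-\nabla f(\mathbf{x})\|_2^2\le C_f$ for all $\mathbf{x}$, where the expectation is over the randomly sampled index $i$; (iv) $\|\partial h(\mathbf{x})\|_2^2\le C_h$ for all $\mathbf{x}$, where $\partial h(\mathbf{x})$ stands for any subgradient of $h$ at $\mathbf{x}$. Let $\mathbf{x}^*$ be the optimal solution of the problem. At time $t$, set the step-size of the DAP-SGD recursion (defined in the context) as $\eta_t=O(1/t)$. Then the iterate $\mathbf{x}_T$ generated by the DAP-SGD recursion at time $T$ satisfies $$\mathbb{E}\|\mathbf{x}_T-\mathbf{x}^*\|_2^2\le O\left(\frac{\log T}{T}\right).$$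
   Context: Here $f_i:\mathbb{R}^m\to\mathbb{R}$ is the empirical loss of the $i$-th of $n$ samples, $h$ is a (usually non-smooth) regularization term, and $\mu$, $L$, $C_f$, $C_h$ are constants. Strong convexity with constant $\mu$: $f(\mathbf{x})\ge f(\mathbf{y})+\langle\nabla f(\mathbf{y}),\mathbf{x}-\mathbf{y}\rangle+\frac{\mu}{2}\|\mathbf{x}-\mathbf{y}\|_2^2$ for all $\mathbf{x},\mathbf{y}$. Proximal operator: $\mathrm{Prox}_{\eta,h}(\mathbf{x})=\arg\min_{\mathbf{y}}\left\{\frac{1}{2\eta}\|\mathbf{y}-\mathbf{x}\|_2^2+h(\mathbf{y})\right\}$. DAP-SGD (decoupled asynchronous proximal stochastic gradient descent): workers and a master run asynchronously from an initial point $\mathbf{x}_0$. A worker samples an index uniformly from $\{1,\dots,n\}$, reads the current parameter and step-size from the master, evaluates the gradient of the sampled loss and then the proximal operator, and sends the resulting increment to the master. At iteration $t$ the master receives an increment computed at the possibly outdated iterate $\mathbf{x}_{d(t)}$, where $d(t)\in[t-\tau,t]$, $d(t)\ge 0$, and $\tau$ is the maximum delay. The recursion is $$\mathbf{x}'_{d(t)}=\mathrm{Prox}_{\eta_{d(t)},h}\big(\mathbf{x}_{d(t)}-\eta_{d(t)}\nabla f_{i_{d(t)}}(\mathbf{x}_{d(t)})\big),\qquad \mathbf{x}_{t+1}=\mathbf{x}_t+\mathbf{x}'_{d(t)}-\mathbf{x}_{d(t)},$$ where $\eta_t$ is the step-size at iteration $t$ and $i_{d(t)}$ is the uniformly sampled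 index used for the increment, independent of $\mathbf{x}_{d(t)}$. $T$ is the total number of iterations.
   Formalization: The step-sizes are positive, O(1/t), and also assumed to satisfy η_t ≥ 1/(2μt) for all large t; with only the upper bound the claim fails, e.g. f=(μ/2)x², h=0, no delay, η_t=c/t with 2μc<1 gives order T^(-2μc). *)

theory Defs
  imports "HOL-Probability.Probability" "HOL-Library.Landau_Symbols"
begin

definition gradient :: "('a::real_inner \<Rightarrow> real) \<Rightarrow> 'a \<Rightarrow> 'a" where
  "gradient f x = (THE D. GDERIV f x :> D)"

definition strongly_convex :: "real \<Rightarrow> ('a::real_inner \<Rightarrow> real) \<Rightarrow> bool" where
  "strongly_convex \<mu> f \<longleftrightarrow>
     (\<forall>x y. f x \<ge> f y + gradient f y \<bullet> (x - y) + \<mu> / 2 * (norm (x - y))\<^sup>2)"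

definition subdifferential :: "('a::real_inner \<Rightarrow> real) \<Rightarrow> 'a \<Rightarrow> 'a set" where
  "subdifferential h x = {g. \<forall>y. h y \<ge> h x + g \<bullet> (y - x)}"

definition prox :: "real \<Rightarrow> ('a::real_inner \<Rightarrow> real) \<Rightarrow> 'a \<Rightarrow> 'a" where
  "prox \<eta> h x = arg_min (\<lambda>y. 1 / (2 * \<eta>) * (norm (y - x))\<^sup>2 + h y) (\<lambda>_. True)"

(* A run of T iterations of decoupled asynchronous proximal SGD on the probability space M.
   d t is the index of the outdated iterate on which the increment received at iteration t is
   based, and i t is the sample index drawn for that increment.  Increments received at different
   iterations may be based on the same iterate, so the sample indices are numbered by the receiving
   iteration; a run with one sample j s per iterate x s is the case i t = j (d t).  No independence
   is required beyond that of i t and x (d t).  The library's indep_var needs both random variables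
   to have the same value type, so independence is stated for the generated sigma-algebras.
   Each x t with t \<le> T is a function of finitely many finitely valued sample indices, hence
   simple, so every expectation of a function of x t exists. *)
definition dap_sgd_run ::
  "nat \<Rightarrow> (nat \<Rightarrow> 'a::euclidean_space \<Rightarrow> real) \<Rightarrow> ('a \<Rightarrow> real) \<Rightarrow> (nat \<Rightarrow> real) \<Rightarrow> nat \<Rightarrow> 'a \<Rightarrow>
   nat \<Rightarrow> 'w measure \<Rightarrow> (nat \<Rightarrow> nat) \<Rightarrow> (nat \<Rightarrow> 'w \<Rightarrow> nat) \<Rightarrow> (nat \<Rightarrow> 'w \<Rightarrow> 'a) \<Rightarrow> bool" where
  "dap_sgd_run n fs h \<eta> \<tau> x\<^sub>0 T M d i x \<longleftrightarrow>
     prob_space M \<and>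
     (\<forall>\<omega>\<in>space M. x 0 \<omega> = x\<^sub>0) \<and>
     (\<forall>t<T.
        d t \<le> t \<and> t \<le> d t + \<tau> \<and>
        i t \<in> M \<rightarrow>\<^sub>M count_space {1..n} \<and>
        distr M (count_space {1..n}) (i t) = uniform_count_measure {1..n} \<and>
        x (d t) \<in> borel_measurable M \<and>
        prob_space.indep_set M
          (sets (vimage_algebra (space M) (i t) (count_space {1..n})))
          (sets (vimage_algebra (space M) (x (d t)) borel)) \<and>
        (\<forall>\<omega>\<in>space M.
           x (Suc t) \<omega> =
             x t \<omega>
             + prox (\<eta> (d t)) h
                 (x (d t) \<omega> - \<eta> (d t) *\<^sub>R gradient (fs (i t \<omega>)) (x (d t) \<omega>))
             - x (d t) \<omega>))"

end

theory Submission
  imports Defs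
begin

text \<open>
  By optimality of the proximal point, an increment based on the iterate \<open>y\<close> equals
  \<open>- \<eta> (g + p)\<close> with \<open>g\<close> the sampled gradient at \<open>y\<close> and \<open>p\<close> a subgradient of \<open>h\<close> at the proximal
  point. Comparing \<open>p\<close> with the subgradient \<open>- \<nabla>f(x*)\<close> of \<open>h\<close> at \<open>x*\<close>, monotonicity of the
  subdifferential and strong convexity of \<open>f\<close> make the increment contract \<open>|y - x*|\<^sup>2\<close> by the
  factor \<open>1 - 2 \<mu> \<eta>\<close>, up to mean-zero noise and terms of order \<open>\<eta>\<^sup>2\<close>. The contraction
  transfers from the outdated iterate \<open>y\<close> to the current one, because at most \<open>\<tau>\<close> increments of
  size \<open>O(1/t)\<close> in mean square separate the two. With \<open>a\<^sub>t = E|x\<^sub>t - x*|\<^sup>2\<close> and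
  \<open>A\<close> an upper bound of \<open>a\<^sub>0, ..., a\<^sub>t\<close> this yields
  \<open>a\<^sub>t\<^sub>+\<^sub>1 \<le> (1 - 2 \<mu> \<eta>) a\<^sub>t + K (1 + A) / (t + 1)\<^sup>2\<close>. Since \<open>1/t\<^sup>2\<close> is summable, \<open>a\<close> is bounded
  uniformly over all runs; then \<open>2 \<mu> \<eta> \<ge> 1/t\<close> gives \<open>t a\<^sub>t\<^sub>+\<^sub>1 \<le> (t - 1) a\<^sub>t + K'/t\<close>, and summing
  the harmonic series gives \<open>a\<^sub>T = O(log T / T)\<close>.
\<close>

subsection \<open>Gradients, subdifferentials and the proximal operator\<close>

lemma gradient_eqI:
  assumes "GDERIV f x :> D"
  shows "gradient f x = D"
  unfolding gradient_def
proof (rule the_equality, rule assms)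
  fix D' assume "GDERIV f x :> D'"
  with assms have "(\<lambda>h. h \<bullet> D') = (\<lambda>h. h \<bullet> D)"
    unfolding gderiv_def using has_derivative_unique by blast
  then show "D' = D"
    by (metis vector_eq_ldot)
qed

text \<open>In finite dimension a derivative is represented by the vector of its values on the
  basis. Uniqueness of that vector makes the definite description in \<open>gradient\<close> denote
  it.\<close>

lemma GDERIV_gradient:
  fixes f :: "'a::euclidean_space \<Rightarrow> real"
  assumes "f differentiable (at x)"
  shows "GDERIV f x :> gradient f x"
proof -
  obtain f' where f': "(f has_derivative f') (at x)"
    using assms by (auto simp: differentiable_def)
  interpret linear f' using f' by (rule has_derivative_linear)
  define D where "D = (\<Sum>b\<in>Basis. f' b *\<^sub>R b)"
  have "f' v = v \<bullet> D" for v
  proof -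
    have "f' v = f' (\<Sum>b\<in>Basis. (v \<bullet> b) *\<^sub>R b)" by (simp add: euclidean_representation)
    also have "\<dots> = v \<bullet> D" by (simp add: D_def sum scaleR inner_sum_right mult.commute)
    finally show ?thesis .
  qed
  then have "f' = (\<lambda>v. v \<bullet> D)" by blast
  with f' have "GDERIV f x :> D" by (simp add: gderiv_def)
  then show ?thesis using gradient_eqI by metis
qed

lemma gradient_mean:
  fixes fs :: "nat \<Rightarrow> 'a::euclidean_space \<Rightarrow> real"
  assumes "\<And>k. k \<in> {1..n} \<Longrightarrow> fs k differentiable (at x)"
  shows "gradient (\<lambda>x. 1 / real n * (\<Sum>k = 1..n. fs k x)) x
    = (1 / real n) *\<^sub>R (\<Sum>k = 1..n. gradient (fs k) x)"
proof (rule gradient_eqI)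
  have "((\<lambda>x. 1 / real n * (\<Sum>k = 1..n. fs k x)) has_derivative
      (\<lambda>v. 1 / real n * (\<Sum>k = 1..n. v \<bullet> gradient (fs k) x))) (at x)"
    using GDERIV_gradient[OF assms] unfolding gderiv_def
    by (intro has_derivative_mult_right has_derivative_sum) auto
  then show "GDERIV (\<lambda>x. 1 / real n * (\<Sum>k = 1..n. fs k x)) x
      :> (1 / real n) *\<^sub>R (\<Sum>k = 1..n. gradient (fs k) x)"
    by (simp add: gderiv_def inner_sum_right)
qed

text \<open>Minimality along the segment from \<open>u\<close> to \<open>y\<close>, convexity of
  \<open>h\<close> and the bound on \<open>F\<close> give 0 \<le> s D + s^2 K(v); dividing by
  \<open>s\<close> and making \<open>s\<close> small leaves D \<ge> 0. The one-sided quadratic bound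
  on \<open>F\<close> serves two purposes: optimality of the proximal point and optimality of
  \<open>xstar\<close>.\<close>

lemma neg_gradient_in_subdifferential:
  fixes F h :: "'a::real_inner \<Rightarrow> real"
  assumes h: "convex_on UNIV h"
    and min: "\<And>y. F u + h u \<le> F y + h y"
    and F: "\<And>v s. \<lbrakk>0 < s; s \<le> 1\<rbrakk> \<Longrightarrow> F (u + s *\<^sub>R v) \<le> F u + s * (g \<bullet> v) + s\<^sup>2 * K v"
  shows "- g \<in> subdifferential h u"
proof -
  have "h u + - g \<bullet> (y - u) \<le> h y" for y
  proof (rule ccontr)
    define v where "v = y - u"
    define D where "D = h y - h u + g \<bullet> v"
    assume "\<not> ?thesis"
    then have D: "D < 0" by (simp add: D_def v_def)
    have lower: "D \<ge> - s * K v" if s: "0 < s" "s \<le> 1" for s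
    proof -
      have "u + s *\<^sub>R v = (1 - s) *\<^sub>R u + s *\<^sub>R y" by (simp add: v_def algebra_simps)
      then have "h (u + s *\<^sub>R v) \<le> (1 - s) * h u + s * h y"
        using convex_onD[OF h, of s u y] s by simp
      then have "0 \<le> s * D + s\<^sup>2 * K v"
        using min[of "u + s *\<^sub>R v"] F[OF s, of v] by (simp add: D_def algebra_simps)
      then have "0 \<le> s * (D + s * K v)" by (simp add: power2_eq_square algebra_simps)
      then show ?thesis using s by (simp add: zero_le_mult_iff)
    qed
    \<comment> \<open>The second argument of \<open>min\<close> makes \<open>s * K v\<close> at most
      \<open>- D / 2\<close>, so \<open>lower\<close> would force \<open>D \<ge> D / 2\<close>,
      which is false for negative \<open>D\<close>.\<close>
    define s where "s = min 1 (- D / (2 * (\<bar>K v\<bar> + 1)))"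
    have s: "0 < s" "s \<le> 1" using D by (auto simp: s_def divide_simps)
    have "s * K v \<le> s * (\<bar>K v\<bar> + 1)" using s by (intro mult_left_mono) auto
    also have "\<dots> \<le> - D / (2 * (\<bar>K v\<bar> + 1)) * (\<bar>K v\<bar> + 1)"
      by (intro mult_right_mono) (auto simp: s_def)
    also have "\<dots> = - D / 2" by (simp add: field_simps)
    finally show False using lower[OF s] D by linarith
  qed
  then show ?thesis by (auto simp: subdifferential_def)
qed

text \<open>\<open>prox\<close> is a choice among minimizers, so a minimizer has to exist first. The
  subgradient \<open>q\<close> gives an affine minorant of \<open>h\<close>, which the quadratic
  term dominates far from \<open>z\<close>; on a closed ball compactness applies.\<close>

lemma prox_is_minimizer:
  fixes h :: "'a::euclidean_space \<Rightarrow> real"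
  assumes h: "convex_on UNIV h" and q: "q \<in> subdifferential h u" and \<eta>: "\<eta> > 0"
  shows "1 / (2 * \<eta>) * (norm (prox \<eta> h z - z))\<^sup>2 + h (prox \<eta> h z)
    \<le> 1 / (2 * \<eta>) * (norm (y - z))\<^sup>2 + h y"
proof -
  define \<phi> where "\<phi> = (\<lambda>y. 1 / (2 * \<eta>) * (norm (y - z))\<^sup>2 + h y)"
  \<comment> \<open>\<open>c\<close> is the value at \<open>z\<close> of the affine minorant.
    Outside radius \<open>R\<close> the quadratic term exceeds the linear one by at least the
    distance \<open>r\<close>, and \<open>r\<close> also covers the gap between \<open>h z\<close>
    and \<open>c\<close>.\<close>
  define c where "c = h u + q \<bullet> (z - u)"
  define R where "R = 2 * \<eta> * (norm q + 1) + \<bar>h z - c\<bar>"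
  have R: "R \<ge> 0" using \<eta> by (simp add: R_def)
  have far: "\<phi> z \<le> \<phi> y" if "y \<notin> cball z R" for y
  proof -
    define r where "r = norm (y - z)"
    have r: "r \<ge> R" using that by (simp add: r_def dist_norm norm_minus_commute)
    have "r / (2 * \<eta>) \<ge> norm q + 1"
      using r \<eta> by (simp add: R_def field_simps)
    then have "r * (r / (2 * \<eta>) - norm q) \<ge> r * 1" by (intro mult_left_mono) (auto simp: r_def)
    then have 1: "1 / (2 * \<eta>) * r\<^sup>2 - norm q * r \<ge> r" by (simp add: power2_eq_square algebra_simps)
    have "h y \<ge> h u + q \<bullet> (y - u)" using q by (auto simp: subdifferential_def)
    also have "h u + q \<bullet> (y - u) = c + q \<bullet> (y - z)" by (simp add: c_def inner_diff_right)
    finally have "h y \<ge> c - norm q * r"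
      using Cauchy_Schwarz_ineq2[of q "y - z"] by (simp add: r_def)
    moreover have "r \<ge> \<bar>h z - c\<bar>"
    proof -
      have "2 * \<eta> * (norm q + 1) \<ge> 0" using \<eta> by simp
      then show ?thesis using r by (simp add: R_def)
    qed
    ultimately show ?thesis using 1 by (simp add: \<phi>_def r_def)
  qed
  have "continuous_on UNIV h" using h by (intro convex_on_continuous) auto
  then have "continuous_on (cball z R) \<phi>"
    unfolding \<phi>_def by (intro continuous_intros) (auto intro: continuous_on_subset)
  then obtain w where w: "w \<in> cball z R" "\<And>y. y \<in> cball z R \<Longrightarrow> \<phi> w \<le> \<phi> y"
    using continuous_attains_inf[of "cball z R" \<phi>] R by auto
  have w_min: "\<phi> w \<le> \<phi> y" for y
    using w(2)[of y] w(2)[of z] far[of y] R by (cases "y \<in> cball z R") auto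
  have "is_arg_min \<phi> (\<lambda>_. True) (prox \<eta> h z)"
    unfolding prox_def arg_min_def \<phi>_def[symmetric]
    by (rule someI[of _ w]) (simp add: is_arg_min_def not_less w_min)
  then have "\<phi> (prox \<eta> h z) \<le> \<phi> y" by (simp add: is_arg_min_def not_less)
  then show ?thesis by (simp add: \<phi>_def)
qed

text \<open>A proximal step is an implicit subgradient step. The quadratic term expands exactly
  around its minimizer \<open>w\<close>, with gradient \<open>(1 / \<eta>) *\<^sub>R (w - z)\<close>
  there, so the negative of this vector is the subgradient \<open>p\<close>.\<close>

lemma prox_subgradient:
  fixes h :: "'a::euclidean_space \<Rightarrow> real"
  assumes h: "convex_on UNIV h" and q: "q \<in> subdifferential h u" and \<eta>: "\<eta> > 0"
  obtains p where "p \<in> subdifferential h (prox \<eta> h z)" "prox \<eta> h z = z - \<eta> *\<^sub>R p"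
proof
  define w where "w = prox \<eta> h z"
  have eq: "1 / (2 * \<eta>) * (norm (w + s *\<^sub>R v - z))\<^sup>2
      = 1 / (2 * \<eta>) * (norm (w - z))\<^sup>2 + s * ((1 / \<eta>) *\<^sub>R (w - z) \<bullet> v)
        + s\<^sup>2 * (1 / (2 * \<eta>) * (norm v)\<^sup>2)" for s v
  proof -
    have "(norm (w - z + s *\<^sub>R v))\<^sup>2 = (norm (w - z))\<^sup>2 + 2 * s * ((w - z) \<bullet> v) + s\<^sup>2 * (norm v)\<^sup>2"
      unfolding power2_norm_eq_inner inner_add_left inner_add_right
      by (simp add: inner_commute power2_eq_square algebra_simps)
    moreover have "w - z + s *\<^sub>R v = w + s *\<^sub>R v - z" by simp
    ultimately have "(norm (w + s *\<^sub>R v - z))\<^sup>2 = (norm (w - z))\<^sup>2 + 2 * s * ((w - z) \<bullet> v) + s\<^sup>2 * (norm v)\<^sup>2"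
      by simp
    then show ?thesis using \<eta> by (simp only: inner_scaleR_left) (simp add: field_simps)
  qed
  have "- ((1 / \<eta>) *\<^sub>R (w - z)) \<in> subdifferential h w"
    by (rule neg_gradient_in_subdifferential[where F = "\<lambda>y. 1 / (2 * \<eta>) * (norm (y - z))\<^sup>2", OF h])
      (use prox_is_minimizer[OF h q \<eta>, of z] in \<open>simp add: w_def\<close>, rule eq_refl, rule eq)
  then show "(1 / \<eta>) *\<^sub>R (z - w) \<in> subdifferential h w"
    by (metis minus_diff_eq scaleR_minus_right)
  show "w = z - \<eta> *\<^sub>R ((1 / \<eta>) *\<^sub>R (z - w))" using \<eta> by simp
qed

lemma subdifferential_monotone:
  assumes "p \<in> subdifferential h x" "q \<in> subdifferential h y"
  shows "(p - q) \<bullet> (x - y) \<ge> 0"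
proof -
  have "h y \<ge> h x + p \<bullet> (y - x)" "h x \<ge> h y + q \<bullet> (x - y)"
    using assms by (auto simp: subdifferential_def)
  then show ?thesis by (simp add: algebra_simps inner_diff_left inner_diff_right)
qed

text \<open>Adding the defining inequality to its copy with \<open>x\<close> and \<open>y\<close>
  exchanged cancels the function values, and the two halves of \<mu> add up.\<close>

lemma strongly_convex_gradient_monotone:
  assumes "strongly_convex \<mu> f"
  shows "(gradient f x - gradient f y) \<bullet> (x - y) \<ge> \<mu> * (norm (x - y))\<^sup>2"
proof -
  have "f x \<ge> f y + gradient f y \<bullet> (x - y) + \<mu> / 2 * (norm (x - y))\<^sup>2"
    "f y \<ge> f x + gradient f x \<bullet> (y - x) + \<mu> / 2 * (norm (y - x))\<^sup>2"
    using assms unfolding strongly_convex_def by blast+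
  then show ?thesis by (simp add: norm_minus_commute inner_diff_left inner_diff_right)
qed

subsection \<open>One proximal step\<close>

lemma norm_add3_squared_le:
  fixes a b c :: "'a::real_inner"
  shows "(norm (a + b + c))\<^sup>2 \<le> 3 * ((norm a)\<^sup>2 + (norm b)\<^sup>2 + (norm c)\<^sup>2)"
proof -
  have "0 \<le> (norm (a - b))\<^sup>2 + (norm (b - c))\<^sup>2 + (norm (a - c))\<^sup>2" by simp
  then show ?thesis
    by (simp add: power2_norm_eq_inner inner_add_left inner_add_right inner_diff_left
        inner_diff_right inner_commute)
qed

lemma norm_sum_squared_le:
  fixes w :: "'b \<Rightarrow> 'a::real_normed_vector"
  assumes "finite S"
  shows "(norm (\<Sum>s\<in>S. w s))\<^sup>2 \<le> real (card S) * (\<Sum>s\<in>S. (norm (w s))\<^sup>2)"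
proof -
  have "(norm (\<Sum>s\<in>S. w s))\<^sup>2 \<le> (\<Sum>s\<in>S. norm (w s))\<^sup>2"
    by (intro power_mono norm_sum) auto
  also have "\<dots> \<le> real (card S) * (\<Sum>s\<in>S. (norm (w s))\<^sup>2)"
    using sum_squared_le_sum_of_squares[of "\<lambda>s. norm (w s)" S] by (simp add: mult.commute)
  finally show ?thesis .
qed

locale regularized_problem =
  fixes f h :: "'a::euclidean_space \<Rightarrow> real" and \<mu> L C\<^sub>h :: real and xstar :: 'a
  assumes mu_pos: "\<mu> > 0"
    and f_strong: "strongly_convex \<mu> f"
    and h_convex: "convex_on UNIV h"
    and f_lipschitz: "L-lipschitz_on UNIV (gradient f)"
    and subgrad: "\<And>x g. g \<in> subdifferential h x \<Longrightarrow> (norm g)\<^sup>2 \<le> C\<^sub>h"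
    and optimal: "is_arg_min (\<lambda>x. f x + h x) (\<lambda>_. True) xstar"
begin

lemma gradient_lipschitz: "norm (gradient f x - gradient f y) \<le> L * norm (x - y)"
  using f_lipschitz by (auto simp: lipschitz_on_def dist_norm)

text \<open>The upper bound on \<open>f\<close> comes from convexity based at the moved point
  \<open>y\<close>; replacing the gradient at \<open>y\<close> by the one at \<open>xstar\<close>
  then costs only a term of order s^2, by the Lipschitz condition.\<close>

lemma optimality: "- gradient f xstar \<in> subdifferential h xstar"
proof (rule neg_gradient_in_subdifferential[where F = f and K = "\<lambda>v. L * (norm v)\<^sup>2", OF h_convex])
  show "f xstar + h xstar \<le> f y + h y" for y
    using optimal by (simp add: is_arg_min_def not_less)
next
  fix v :: 'a and s :: real assume s: "0 < s" "s \<le> 1"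
  define y where "y = xstar + s *\<^sub>R v"
  have "f xstar \<ge> f y + gradient f y \<bullet> (xstar - y) + \<mu> / 2 * (norm (xstar - y))\<^sup>2"
    using f_strong unfolding strongly_convex_def by blast
  moreover have "\<mu> / 2 * (norm (xstar - y))\<^sup>2 \<ge> 0" using mu_pos by simp
  ultimately have "f y \<le> f xstar - gradient f y \<bullet> (xstar - y)" by linarith
  also have "\<dots> = f xstar + s * (gradient f xstar \<bullet> v) + s * ((gradient f y - gradient f xstar) \<bullet> v)"
    by (simp add: y_def inner_diff_left algebra_simps)
  also have "(gradient f y - gradient f xstar) \<bullet> v \<le> (L * norm (y - xstar)) * norm v"
    using norm_cauchy_schwarz[of "gradient f y - gradient f xstar" v]
      mult_right_mono[OF gradient_lipschitz[of y xstar], of "norm v"] by simp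
  also have "L * norm (y - xstar) * norm v = s * (L * (norm v)\<^sup>2)"
    using s by (simp add: y_def power2_eq_square)
  finally show "f (xstar + s *\<^sub>R v) \<le> f xstar + s * (gradient f xstar \<bullet> v) + s\<^sup>2 * (L * (norm v)\<^sup>2)"
    using s by (simp add: y_def power2_eq_square algebra_simps)
qed

lemma C\<^sub>h_nonneg: "C\<^sub>h \<ge> 0"
  using subgrad[OF optimality] zero_le_power2[of "norm (- gradient f xstar)"] by linarith

text \<open>\<open>y\<close> is the outdated iterate at which the increment is computed,
  \<open>z\<close> the current iterate to which it is added. With \<open>q\<close> the negative
  gradient of \<open>f\<close> at \<open>xstar\<close>, the vector \<open>g + p\<close> splits into
  sampling noise, a gradient difference controlled by \<open>L\<close>, and \<open>p - q\<close>,
  whose square is at most \<open>4 * C\<^sub>h\<close>.\<close>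

lemma proximal_step:
  fixes y g :: 'a
  assumes \<eta>: "\<eta> > 0"
  defines "\<Delta> \<equiv> prox \<eta> h (y - \<eta> *\<^sub>R g) - y"
  shows proximal_step_increment:
    "(norm \<Delta>)\<^sup>2 \<le> 3 * \<eta>\<^sup>2 * ((norm (g - gradient f y))\<^sup>2 + L\<^sup>2 * (norm (y - xstar))\<^sup>2 + 4 * C\<^sub>h)"
    and proximal_step_progress:
    "(norm (z + \<Delta> - xstar))\<^sup>2
      \<le> (1 - 2 * \<mu> * \<eta>) * (norm (z - xstar))\<^sup>2
        - 2 * \<eta> * ((g - gradient f y) \<bullet> (y - xstar))
        + 3 * (norm \<Delta>)\<^sup>2 + 4 * C\<^sub>h * \<eta>\<^sup>2
        + (3 + 2 * \<mu> * \<eta>) * (norm (z - y))\<^sup>2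
        + 2 * (\<mu> * \<eta>)\<^sup>2 * (norm (y - xstar))\<^sup>2"
proof -
  define q where "q = - gradient f xstar"
  have q: "q \<in> subdifferential h xstar" using optimality by (simp add: q_def)
  obtain p where p: "p \<in> subdifferential h (prox \<eta> h (y - \<eta> *\<^sub>R g))"
    and p_eq: "prox \<eta> h (y - \<eta> *\<^sub>R g) = y - \<eta> *\<^sub>R g - \<eta> *\<^sub>R p"
    by (rule prox_subgradient[OF h_convex q \<eta>])
  have \<Delta>: "\<Delta> = - (\<eta> *\<^sub>R (g + p))" by (simp add: \<Delta>_def p_eq algebra_simps)
  have pq: "(norm (p - q))\<^sup>2 \<le> 4 * C\<^sub>h"
  proof -
    have "(norm (p - q))\<^sup>2 \<le> 2 * (norm p)\<^sup>2 + 2 * (norm q)\<^sup>2"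
      using zero_le_power2[of "norm (p + q)"]
      by (simp add: power2_norm_eq_inner inner_add_left inner_add_right inner_diff_left
          inner_diff_right inner_commute)
    then show ?thesis using subgrad[OF p] subgrad[OF q] by simp
  qed
  define u v w e where "u = y - xstar" and "v = z - y" and "w = z - xstar" and "e = g - gradient f y"
  have "g + p = e + (gradient f y - gradient f xstar) + (p - q)"
    by (simp add: e_def q_def)
  then have "(norm (g + p))\<^sup>2 \<le> 3 * ((norm e)\<^sup>2 + (norm (gradient f y - gradient f xstar))\<^sup>2
      + (norm (p - q))\<^sup>2)"
    by (metis norm_add3_squared_le)
  also have "(norm (gradient f y - gradient f xstar))\<^sup>2 \<le> (L * norm u)\<^sup>2"
    unfolding u_def by (intro power_mono gradient_lipschitz) simp
  also have "\<dots> = L\<^sup>2 * (norm u)\<^sup>2" by (simp add: power_mult_distrib)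
  finally have "(norm (g + p))\<^sup>2 \<le> 3 * ((norm e)\<^sup>2 + L\<^sup>2 * (norm u)\<^sup>2 + 4 * C\<^sub>h)"
    using pq by simp
  then have "\<eta>\<^sup>2 * (norm (g + p))\<^sup>2 \<le> \<eta>\<^sup>2 * (3 * ((norm e)\<^sup>2 + L\<^sup>2 * (norm u)\<^sup>2 + 4 * C\<^sub>h))"
    by (intro mult_left_mono) auto
  moreover have "(norm \<Delta>)\<^sup>2 = \<eta>\<^sup>2 * (norm (g + p))\<^sup>2"
    unfolding \<Delta> by (simp only: norm_minus_cancel norm_scaleR power_mult_distrib power2_abs)
  ultimately show "(norm \<Delta>)\<^sup>2 \<le> 3 * \<eta>\<^sup>2 * ((norm (g - gradient f y))\<^sup>2 + L\<^sup>2 * (norm (y - xstar))\<^sup>2 + 4 * C\<^sub>h)"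
    unfolding e_def u_def by (simp only: mult.assoc mult.left_commute)

  have w: "w = u + v" by (simp add: u_def v_def w_def)
  have expand: "(norm (w + \<Delta>))\<^sup>2 = (norm w)\<^sup>2 + 2 * (u \<bullet> \<Delta>) + 2 * (v \<bullet> \<Delta>) + (norm \<Delta>)\<^sup>2"
    by (simp add: w power2_norm_eq_inner inner_add_left inner_add_right inner_commute)
  have v\<Delta>: "2 * (v \<bullet> \<Delta>) \<le> (norm v)\<^sup>2 + (norm \<Delta>)\<^sup>2"
    using zero_le_power2[of "norm (v - \<Delta>)"]
    by (simp add: power2_norm_eq_inner inner_diff_left inner_diff_right inner_commute)
  \<comment> \<open>The subgradient \<open>p\<close> belongs to the proximal point, so monotonicity
    speaks of \<open>u + \<Delta>\<close> instead of \<open>u\<close>. The shift by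
    \<open>\<Delta>\<close> is paid for by Young's inequality with terms of second order in the
    step-size.\<close>
  have "(p - q) \<bullet> (prox \<eta> h (y - \<eta> *\<^sub>R g) - xstar) \<ge> 0"
    by (rule subdifferential_monotone[OF p q])
  then have "(p - q) \<bullet> (u + \<Delta>) \<ge> 0" by (simp add: u_def \<Delta>_def)
  then have "2 * \<eta> * ((p - q) \<bullet> (u + \<Delta>)) \<ge> 0" using \<eta> by simp
  moreover have "2 * ((\<eta> *\<^sub>R (p - q)) \<bullet> \<Delta>) \<le> (norm (\<eta> *\<^sub>R (p - q)))\<^sup>2 + (norm \<Delta>)\<^sup>2"
    using zero_le_power2[of "norm (\<eta> *\<^sub>R (p - q) - \<Delta>)"]
    unfolding power2_norm_eq_inner inner_diff_left[of "\<eta> *\<^sub>R (p - q)"]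
      inner_diff_right[of _ "\<eta> *\<^sub>R (p - q)"] by (simp add: inner_commute)
  moreover have "(norm (\<eta> *\<^sub>R (p - q)))\<^sup>2 \<le> 4 * C\<^sub>h * \<eta>\<^sup>2"
    using mult_left_mono[OF pq, of "\<eta>\<^sup>2"] by (simp add: power_mult_distrib mult_ac)
  ultimately have prox_part: "- 2 * \<eta> * ((p - q) \<bullet> u) \<le> 4 * C\<^sub>h * \<eta>\<^sup>2 + (norm \<Delta>)\<^sup>2"
    by (simp add: inner_add_right algebra_simps)
  have "(gradient f y - gradient f xstar) \<bullet> u \<ge> \<mu> * (norm u)\<^sup>2"
    unfolding u_def by (rule strongly_convex_gradient_monotone[OF f_strong])
  then have grad_part: "- 2 * \<eta> * ((gradient f y - gradient f xstar) \<bullet> u) \<le> - 2 * \<eta> * (\<mu> * (norm u)\<^sup>2)"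
    using \<eta> by simp
  have "2 * (u \<bullet> \<Delta>) = - 2 * \<eta> * (e \<bullet> u) - 2 * \<eta> * ((gradient f y - gradient f xstar) \<bullet> u)
      - 2 * \<eta> * ((p - q) \<bullet> u)"
    by (simp add: \<Delta> e_def q_def inner_add_left inner_add_right inner_diff_left inner_diff_right
        inner_commute algebra_simps)
  then have u\<Delta>: "2 * (u \<bullet> \<Delta>) \<le> - 2 * \<eta> * (e \<bullet> u) - 2 * \<eta> * (\<mu> * (norm u)\<^sup>2) + 4 * C\<^sub>h * \<eta>\<^sup>2 + (norm \<Delta>)\<^sup>2"
    using grad_part prox_part by linarith
  \<comment> \<open>So far the contraction acts on the outdated error \<open>u\<close>; it is now
    moved to the current error \<open>w = u + v\<close>. Young's inequality puts the weight
    \<open>c\<close> on \<open>u\<close>, so that \<open>(norm u)\<^sup>2\<close> returns with the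
    factor c^2 and not with a first-order factor that would spoil the contraction.\<close>
  define c where "c = \<mu> * \<eta>"
  have "(norm (c *\<^sub>R u - v))\<^sup>2 = c\<^sup>2 * (norm u)\<^sup>2 - 2 * c * (u \<bullet> v) + (norm v)\<^sup>2"
    unfolding power2_norm_eq_inner inner_diff_left inner_diff_right
    by (simp add: inner_commute power2_eq_square algebra_simps)
  then have "2 * c * (u \<bullet> v) \<le> c\<^sup>2 * (norm u)\<^sup>2 + (norm v)\<^sup>2"
    using zero_le_power2[of "norm (c *\<^sub>R u - v)"] by linarith
  moreover have "(norm w)\<^sup>2 = (norm u)\<^sup>2 + 2 * (u \<bullet> v) + (norm v)\<^sup>2"
    by (simp add: w power2_norm_eq_inner inner_add_left inner_add_right inner_commute)
  then have "- 2 * c * (norm u)\<^sup>2 = - 2 * c * (norm w)\<^sup>2 + 4 * c * (u \<bullet> v) + 2 * c * (norm v)\<^sup>2"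
    by (simp add: algebra_simps)
  ultimately have "- 2 * c * (norm u)\<^sup>2 \<le> - 2 * c * (norm w)\<^sup>2 + 2 * c\<^sup>2 * (norm u)\<^sup>2
      + (2 + 2 * c) * (norm v)\<^sup>2"
    by (simp add: algebra_simps)
  then have "(norm (w + \<Delta>))\<^sup>2 \<le> (1 - 2 * c) * (norm w)\<^sup>2 - 2 * \<eta> * (e \<bullet> u) + 3 * (norm \<Delta>)\<^sup>2
      + 4 * C\<^sub>h * \<eta>\<^sup>2 + (3 + 2 * c) * (norm v)\<^sup>2 + 2 * c\<^sup>2 * (norm u)\<^sup>2"
    using expand u\<Delta> v\<Delta> by (simp add: c_def algebra_simps)
  moreover have "w + \<Delta> = z + \<Delta> - xstar" by (simp add: w_def)
  ultimately show "(norm (z + \<Delta> - xstar))\<^sup>2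
      \<le> (1 - 2 * \<mu> * \<eta>) * (norm (z - xstar))\<^sup>2
        - 2 * \<eta> * ((g - gradient f y) \<bullet> (y - xstar))
        + 3 * (norm \<Delta>)\<^sup>2 + 4 * C\<^sub>h * \<eta>\<^sup>2
        + (3 + 2 * \<mu> * \<eta>) * (norm (z - y))\<^sup>2
        + 2 * (\<mu> * \<eta>)\<^sup>2 * (norm (y - xstar))\<^sup>2"
    by (simp only: u_def v_def w_def e_def c_def mult.assoc)
qed

end

subsection \<open>Expectations under an independent uniform sample\<close>

lemma (in prob_space) integrable_simple:
  fixes f :: "'a \<Rightarrow> real"
  assumes "simple_function M f"
  shows "integrable M f"
  by (rule integrable_simple_function[OF assms]) simp

text \<open>The sample is averaged out with the iterate held fixed. Both variables take finitely
  many values, so the integrand is a finite combination of indicators of joint level sets, whose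
  probabilities factor by independence. In a \<open>t1_space\<close> singletons are Borel, so the
  level sets of \<open>X\<close> lie in its generated sigma-algebra.\<close>

lemma (in prob_space) expectation_uniform_indep:
  fixes \<phi> :: "nat \<Rightarrow> 'b::t1_space \<Rightarrow> real"
  assumes n: "n \<ge> 1"
    and i: "i \<in> M \<rightarrow>\<^sub>M count_space {1..n}"
    and unif: "distr M (count_space {1..n}) i = uniform_count_measure {1..n}"
    and X: "simple_function M X"
    and indep: "indep_set (sets (vimage_algebra (space M) i (count_space {1..n})))
                  (sets (vimage_algebra (space M) X borel))"
  shows "expectation (\<lambda>\<omega>. \<phi> (i \<omega>) (X \<omega>)) = expectation (\<lambda>\<omega>. (\<Sum>k = 1..n. \<phi> k (X \<omega>)) / real n)"
proof -
  define V where "V = X ` space M"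
  have V: "finite V" using X by (auto simp: V_def simple_function_def)
  define I where "I k = i -` {k} \<inter> space M" for k
  define W where "W v = X -` {v} \<inter> space M" for v
  have I_sets: "I k \<in> events" if "k \<in> {1..n}" for k
    using that measurable_sets[OF i, of "{k}"] by (simp add: I_def)
  have W_sets: "W v \<in> events" for v
    using simple_functionD(2)[OF X] by (simp add: W_def)
  have prob_I: "prob (I k) = 1 / real n" if "k \<in> {1..n}" for k
  proof -
    have "prob (I k) = measure (distr M (count_space {1..n}) i) {k}"
      using measure_distr[OF i, of "{k}"] that by (simp add: I_def)
    also have "\<dots> = 1 / real n"
      unfolding unif using that by (subst measure_uniform_count_measure) auto
    finally show ?thesis .
  qed
  have prob_IW: "prob (I k \<inter> W v) = prob (W v) / real n" if k: "k \<in> {1..n}" for k v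
  proof -
    have "I k \<in> sets (vimage_algebra (space M) i (count_space {1..n}))"
      unfolding I_def using k by (intro in_vimage_algebra) auto
    moreover have "W v \<in> sets (vimage_algebra (space M) X borel)"
      unfolding W_def by (intro in_vimage_algebra) auto
    ultimately have "prob (I k \<inter> W v) = prob (I k) * prob (W v)"
      by (rule indep_setD[OF indep])
    then show ?thesis using prob_I[OF k] by simp
  qed
  have i_mem: "i \<omega> \<in> {1..n}" if "\<omega> \<in> space M" for \<omega>
    using measurable_space[OF i that] by simp
  have "expectation (\<lambda>\<omega>. \<phi> (i \<omega>) (X \<omega>))
      = expectation (\<lambda>\<omega>. \<Sum>k = 1..n. \<Sum>v\<in>V. \<phi> k v * indicator (I k \<inter> W v) \<omega>)"
  proof (rule Bochner_Integration.integral_cong[OF refl])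
    fix \<omega> assume \<omega>: "\<omega> \<in> space M"
    have "(\<Sum>k = 1..n. \<Sum>v\<in>V. \<phi> k v * indicator (I k \<inter> W v) \<omega>)
        = (\<Sum>k = 1..n. \<Sum>v\<in>V. if X \<omega> = v then (if i \<omega> = k then \<phi> k v else 0) else 0)"
      using \<omega> by (intro sum.cong) (auto simp: I_def W_def indicator_def)
    also have "\<dots> = \<phi> (i \<omega>) (X \<omega>)"
      using \<omega> V i_mem[OF \<omega>] by (simp add: V_def)
    finally show "\<phi> (i \<omega>) (X \<omega>) = (\<Sum>k = 1..n. \<Sum>v\<in>V. \<phi> k v * indicator (I k \<inter> W v) \<omega>)" ..
  qed
  also have "\<dots> = (\<Sum>k = 1..n. \<Sum>v\<in>V. \<phi> k v * prob (I k \<inter> W v))"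
  proof -
    have IW: "I k \<inter> W v \<in> events" if "k \<in> {1..n}" for k v using I_sets[OF that] W_sets by auto
    have int: "integrable M (\<lambda>\<omega>. \<phi> k v * indicator (I k \<inter> W v) \<omega>)" if "k \<in> {1..n}" for k v
      by (rule integrable_mult_right, rule integrable_real_indicator[OF IW[OF that]])
        (simp add: less_top[symmetric])
    have "expectation (\<lambda>\<omega>. \<Sum>k = 1..n. \<Sum>v\<in>V. \<phi> k v * indicator (I k \<inter> W v) \<omega>)
        = (\<Sum>k = 1..n. expectation (\<lambda>\<omega>. \<Sum>v\<in>V. \<phi> k v * indicator (I k \<inter> W v) \<omega>))"
      by (rule Bochner_Integration.integral_sum) (intro Bochner_Integration.integrable_sum int)
    also have "\<dots> = (\<Sum>k = 1..n. \<Sum>v\<in>V. expectation (\<lambda>\<omega>. \<phi> k v * indicator (I k \<inter> W v) \<omega>))"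
      by (intro sum.cong refl Bochner_Integration.integral_sum int)
    also have "\<dots> = (\<Sum>k = 1..n. \<Sum>v\<in>V. \<phi> k v * prob (I k \<inter> W v))"
    proof (intro sum.cong refl)
      fix k v
      have "I k \<inter> W v \<inter> space M = I k \<inter> W v" by (auto simp: I_def)
      then show "expectation (\<lambda>\<omega>. \<phi> k v * indicator (I k \<inter> W v) \<omega>) = \<phi> k v * prob (I k \<inter> W v)"
        by simp
    qed
    finally show ?thesis .
  qed
  also have "\<dots> = (\<Sum>k = 1..n. \<Sum>v\<in>V. \<phi> k v * (prob (W v) / real n))"
    by (intro sum.cong refl) (simp only: prob_IW)
  also have "\<dots> = (\<Sum>v\<in>V. (\<Sum>k = 1..n. \<phi> k v) / real n * prob (W v))"
    by (subst sum.swap) (simp add: sum_distrib_right sum_divide_distrib)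
  also have "\<dots> = expectation (\<lambda>\<omega>. \<Sum>v\<in>V. (\<Sum>k = 1..n. \<phi> k v) / real n * indicator (W v) \<omega>)"
  proof -
    have int: "integrable M (\<lambda>\<omega>. C * indicator (W v) \<omega>)" for v and C :: real
      by (rule integrable_mult_right, rule integrable_real_indicator[OF W_sets])
        (simp add: less_top[symmetric])
    have "W v \<inter> space M = W v" for v by (auto simp: W_def)
    then show ?thesis by (subst Bochner_Integration.integral_sum[OF int]) simp
  qed
  also have "\<dots> = expectation (\<lambda>\<omega>. (\<Sum>k = 1..n. \<phi> k (X \<omega>)) / real n)"
  proof (rule Bochner_Integration.integral_cong[OF refl])
    fix \<omega> assume \<omega>: "\<omega> \<in> space M"
    have "(\<Sum>v\<in>V. (\<Sum>k = 1..n. \<phi> k v) / real n * indicator (W v) \<omega>)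
        = (\<Sum>v\<in>V. if X \<omega> = v then (\<Sum>k = 1..n. \<phi> k v) / real n else 0)"
      using \<omega> by (intro sum.cong) (auto simp: W_def indicator_def)
    also have "\<dots> = (\<Sum>k = 1..n. \<phi> k (X \<omega>)) / real n"
      using \<omega> V by (simp add: V_def)
    finally show "(\<Sum>v\<in>V. (\<Sum>k = 1..n. \<phi> k v) / real n * indicator (W v) \<omega>)
        = (\<Sum>k = 1..n. \<phi> k (X \<omega>)) / real n" .
  qed
  finally show ?thesis .
qed

subsection \<open>Real recursions\<close>

text \<open>A discrete Gronwall argument: a bound on one plus all past values grows per step by at
  most the factor exp(K / (t + 1)^2). The step hypothesis refers to a bound \<open>A\<close> on the
  whole past because a delayed iterate enters the recursion, so the induction carries a
  nondecreasing majorant of all earlier values.\<close>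

lemma perturbed_growth_bounded:
  fixes a :: "nat \<Rightarrow> real"
  assumes K: "K \<ge> 0" and a0: "a 0 \<ge> 0"
    and step: "\<And>t A. \<lbrakk>t < T; \<And>s. s \<le> t \<Longrightarrow> a s \<le> A\<rbrakk> \<Longrightarrow> a (Suc t) \<le> a t + K * (1 + A) / (real t + 1)\<^sup>2"
    and t: "t \<le> T"
  shows "a t \<le> (1 + a 0) * exp (2 * K)"
proof -
  \<comment> \<open>\<open>2 (1 - 1 / (t + 1))\<close> is a telescoping majorant of \<open>\<Sum>s<t. 1 / (s + 1)\<^sup>2\<close>.\<close>
  define W where "W t = (1 + a 0) * exp (2 * K * (1 - 1 / (real t + 1))) - 1" for t :: nat
  have W_mono: "W t \<le> W (Suc t)" for t
  proof -
    have "1 / (real (Suc t) + 1) \<le> 1 / (real t + 1)" by (simp add: frac_le)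
    then have "2 * K * (1 - 1 / (real t + 1)) \<le> 2 * K * (1 - 1 / (real (Suc t) + 1))"
      using K by (intro mult_left_mono) auto
    then show ?thesis using a0 by (simp add: W_def)
  qed
  have W_pos: "1 + W t > 0" for t using a0 by (simp add: W_def)
  have "\<forall>s\<le>t. a s \<le> W t"
    using t
  proof (induction t)
    case 0
    then show ?case by (simp add: W_def)
  next
    case (Suc t)
    then have IH: "\<And>s. s \<le> t \<Longrightarrow> a s \<le> W t" by simp
    have "1 / (real t + 1)\<^sup>2 \<le> 2 * (1 / (real t + 1) - 1 / (real (Suc t) + 1))"
    proof -
      have "2 * (1 / (real t + 1) - 1 / (real (Suc t) + 1)) = 2 / ((real t + 1) * (real t + 2))"
        by (simp add: field_simps)
      moreover have "1 / (real t + 1)\<^sup>2 \<le> 2 / ((real t + 1) * (real t + 2))"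
      proof -
        have "1 / u\<^sup>2 = 2 / (u * (2 * u))" for u :: real by (simp add: power2_eq_square)
        then have "1 / (real t + 1)\<^sup>2 = 2 / ((real t + 1) * (2 * (real t + 1)))" .
        also have "\<dots> \<le> 2 / ((real t + 1) * (real t + 2))"
          by (intro divide_left_mono mult_left_mono) auto
        finally show ?thesis .
      qed
      ultimately show ?thesis by simp
    qed
    then have e: "K * (1 / (real t + 1)\<^sup>2) \<le> K * (2 * (1 / (real t + 1) - 1 / (real (Suc t) + 1)))"
      using K by (intro mult_left_mono) auto
    have "1 + a (Suc t) \<le> 1 + a t + K * (1 + W t) / (real t + 1)\<^sup>2"
      using step[of t "W t"] Suc.prems IH by simp
    also have "\<dots> \<le> (1 + W t) * (1 + K * (1 / (real t + 1)\<^sup>2))"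
      using IH[of t] by (simp add: algebra_simps)
    also have "\<dots> \<le> (1 + W t) * exp (K * (1 / (real t + 1)\<^sup>2))"
      using W_pos[of t] by (intro mult_left_mono exp_ge_add_one_self) auto
    also have "\<dots> \<le> (1 + W t) * exp (K * (2 * (1 / (real t + 1) - 1 / (real (Suc t) + 1))))"
      using e W_pos[of t] by (intro mult_left_mono) auto
    also have "\<dots> = (1 + a 0) * (exp (2 * K * (1 - 1 / (real t + 1)))
        * exp (K * (2 * (1 / (real t + 1) - 1 / (real (Suc t) + 1)))))"
      by (simp add: W_def)
    also have "\<dots> = 1 + W (Suc t)"
      unfolding exp_add[symmetric] by (simp add: W_def algebra_simps)
    finally show ?case
      using IH W_mono[of t] by (force simp: le_Suc_eq intro: order_trans)
  qed
  then have "a t \<le> W t" by simp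
  also have "\<dots> \<le> (1 + a 0) * exp (2 * K * (1 - 1 / (real t + 1)))" by (simp add: W_def)
  also have "\<dots> \<le> (1 + a 0) * exp (2 * K)"
    using a0 K by (intro mult_left_mono) (auto simp: mult_left_le)
  finally show ?thesis .
qed

lemma log_decay:
  fixes a :: "nat \<Rightarrow> real"
  assumes K: "K \<ge> 0" and W: "W \<ge> 0" and a0: "a t\<^sub>0 \<le> W" and t0: "t\<^sub>0 \<ge> 3"
    and step: "\<And>t. \<lbrakk>t\<^sub>0 \<le> t; t < T\<rbrakk> \<Longrightarrow> a (Suc t) \<le> (1 - 1 / real t) * a t + K / (real t)\<^sup>2"
    and T: "t\<^sub>0 \<le> T"
  shows "a T \<le> 2 * (real t\<^sub>0 * W + 2 * K) * (ln (real T) / real T)"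
proof -
  \<comment> \<open>Multiplying the recursion by \<open>t\<close> makes \<open>(t - 1) a\<^sub>t\<close> grow by at most \<open>K / t\<close>.\<close>
  have "(real T - 1) * a T \<le> real t\<^sub>0 * W + 2 * K * ln (real T)"
    using T step
  proof (induction T rule: dec_induct)
    case base
    have "(real t\<^sub>0 - 1) * a t\<^sub>0 \<le> (real t\<^sub>0 - 1) * W" using t0 a0 by (intro mult_left_mono) auto
    also have "\<dots> \<le> real t\<^sub>0 * W" using W by (intro mult_right_mono) auto
    finally show ?case using K t0 by (simp add: add_increasing2)
  next
    case (step t)
    then have t: "t > 0" using t0 by simp
    \<comment> \<open>The term \<open>K / real t\<close> is compared with a telescoping difference
      of logarithms; passing from 1/t to 1/(t + 1) is the origin of the factor 2 in
      \<open>2 * K * ln (real T)\<close>.\<close>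
    have "ln (real t / real (Suc t)) \<le> real t / real (Suc t) - 1"
      using t by (intro ln_le_minus_one) auto
    then have "ln (real (Suc t)) - ln (real t) \<ge> 1 / (real t + 1)"
      using t by (simp add: ln_div field_simps)
    moreover have "1 / real t \<le> 2 * (1 / (real t + 1))" using t by (simp add: field_simps)
    ultimately have "K * (1 / real t) \<le> K * (2 * (ln (real (Suc t)) - ln (real t)))"
      using K by (intro mult_left_mono) auto
    then have l: "K / real t \<le> 2 * K * ln (real (Suc t)) - 2 * K * ln (real t)"
      by (simp add: algebra_simps)
    have "real t * a (Suc t) \<le> real t * ((1 - 1 / real t) * a t + K / (real t)\<^sup>2)"
      using step.prems[of t] step.hyps by (intro mult_left_mono) auto
    also have "\<dots> = (real t - 1) * a t + K / real t"
      using t by (simp add: field_simps power2_eq_square)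
    finally show ?case using step l by simp
  qed
  \<comment> \<open>Since \<open>T\<close> is at least 3, hence at least e, the logarithm absorbs
    the constant \<open>real t\<^sub>0 * W\<close>.\<close>
  moreover have ln: "ln (real T) \<ge> 1"
    using T t0 exp_le by (simp add: ln_ge_iff)
  ultimately have "(real T - 1) * a T \<le> (real t\<^sub>0 * W + 2 * K) * ln (real T)"
    using mult_left_mono[OF ln, of "real t\<^sub>0 * W"] W by (simp add: algebra_simps)
  then have "a T \<le> (real t\<^sub>0 * W + 2 * K) * ln (real T) / (real T - 1)"
    using T t0 by (simp add: pos_le_divide_eq mult.commute)
  also have "\<dots> \<le> (real t\<^sub>0 * W + 2 * K) * ln (real T) / (real T / 2)"
    using T t0 W K ln by (intro divide_left_mono mult_nonneg_nonneg) auto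
  also have "\<dots> = 2 * (real t\<^sub>0 * W + 2 * K) * (ln (real T) / real T)" by simp
  finally show ?thesis .
qed

subsection \<open>Mean squared distance along a run\<close>

text \<open>Collects the data fixed before a run is chosen. The constants
  \<open>K\<^sub>\<Delta>\<close> and \<open>K\<close> are defined at this level, which makes the
  later bounds uniform over probability spaces, horizons and runs.\<close>

locale dap_problem = regularized_problem f h \<mu> L C\<^sub>h xstar
  for f h :: "'a::euclidean_space \<Rightarrow> real" and \<mu> L C\<^sub>h :: real and xstar :: 'a +
  fixes fs :: "nat \<Rightarrow> 'a \<Rightarrow> real" and n \<tau> :: nat and C\<^sub>f c :: real and \<eta> :: "nat \<Rightarrow> real" and x\<^sub>0 :: 'a
  assumes n_pos: "n \<ge> 1"
    and f_eq: "f = (\<lambda>x. 1 / real n * (\<Sum>k = 1..n. fs k x))"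
    and fs_diff: "\<And>k x. k \<in> {1..n} \<Longrightarrow> fs k differentiable (at x)"
    and variance: "\<And>x. (\<integral>k. (norm (gradient (fs k) x - gradient f x))\<^sup>2
                         \<partial>uniform_count_measure {1..n}) \<le> C\<^sub>f"
    and step_pos: "\<And>t. \<eta> t > 0"
    and step_le: "\<And>t. \<eta> t \<le> c / (real t + 1)"
begin

text \<open>Unbiasedness of the sampled gradient: the gradient of the mean loss is the mean of the
  gradients.\<close>

lemma sum_gradient_deviation: "(\<Sum>k = 1..n. gradient (fs k) y - gradient f y) = 0"
proof -
  have "gradient f y = (1 / real n) *\<^sub>R (\<Sum>k = 1..n. gradient (fs k) y)"
    unfolding f_eq by (rule gradient_mean[OF fs_diff])
  then have "real n *\<^sub>R gradient f y = (\<Sum>k = 1..n. gradient (fs k) y)"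
    using n_pos by simp
  then show ?thesis by (simp add: sum_subtractf sum_constant_scaleR)
qed

lemma mean_squared_deviation: "(\<Sum>k = 1..n. (norm (gradient (fs k) y - gradient f y))\<^sup>2) / real n \<le> C\<^sub>f"
  using variance[of y] by (simp add: integral_uniform_count_measure)

lemma C\<^sub>f_nonneg: "C\<^sub>f \<ge> 0"
  by (rule order_trans[OF _ mean_squared_deviation]) (simp add: sum_nonneg)

lemma c_pos: "c > 0"
  using step_pos[of 0] step_le[of 0] by simp

text \<open>Scale of the mean squared increment, to be multiplied by
  \<open>(1 + A) / (real t + 1)\<^sup>2\<close>. The factor \<open>c * (real \<tau> + 1)\<close>
  bounds \<open>real t + 1\<close> times the outdated step-size.\<close>

definition K\<^sub>\<Delta> :: real where
  "K\<^sub>\<Delta> = 3 * (c * (real \<tau> + 1))\<^sup>2 * (C\<^sub>f + L\<^sup>2 + 4 * C\<^sub>h)"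

text \<open>The four summands match the second-order terms of \<open>proximal_step_progress\<close>:
  increment, subgradients, drift since the outdated iterate, and the price of moving the
  contraction.\<close>

definition K :: real where
  "K = 3 * K\<^sub>\<Delta> + 4 * C\<^sub>h * (c * (real \<tau> + 1))\<^sup>2
     + (3 + 2 * \<mu> * c) * ((real \<tau>)\<^sup>2 * (real \<tau> + 1)\<^sup>2 * K\<^sub>\<Delta>) + 2 * (\<mu> * (c * (real \<tau> + 1)))\<^sup>2"

lemma K\<^sub>\<Delta>_nonneg: "K\<^sub>\<Delta> \<ge> 0"
  unfolding K\<^sub>\<Delta>_def using C\<^sub>f_nonneg C\<^sub>h_nonneg by (intro mult_nonneg_nonneg) auto

lemma K_nonneg: "K \<ge> 0"
  unfolding K_def using K\<^sub>\<Delta>_nonneg C\<^sub>h_nonneg mu_pos c_pos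
  by (intro add_nonneg_nonneg mult_nonneg_nonneg) auto

end

section \<open>Delays, integrability and mean squared error along one run\<close>

locale dap_sgd = dap_problem f h \<mu> L C\<^sub>h xstar fs n \<tau> C\<^sub>f c \<eta> x\<^sub>0 + prob_space M
  for f h :: "'a::euclidean_space \<Rightarrow> real" and \<mu> L C\<^sub>h :: real and xstar :: 'a
    and fs :: "nat \<Rightarrow> 'a \<Rightarrow> real" and n \<tau> :: nat and C\<^sub>f c :: real and \<eta> :: "nat \<Rightarrow> real" and x\<^sub>0 :: 'a
    and M :: "'w measure" +
  fixes T :: nat and d :: "nat \<Rightarrow> nat" and i :: "nat \<Rightarrow> 'w \<Rightarrow> nat" and x :: "nat \<Rightarrow> 'w \<Rightarrow> 'a"
  assumes run: "dap_sgd_run n fs h \<eta> \<tau> x\<^sub>0 T M d i x"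
begin

lemma x_0: "\<omega> \<in> space M \<Longrightarrow> x 0 \<omega> = x\<^sub>0"
  using run by (simp add: dap_sgd_run_def)

context
  fixes t assumes t: "t < T"
begin

lemma d_le: "d t \<le> t" and d_ge: "t \<le> d t + \<tau>"
  using run t by (auto simp: dap_sgd_run_def)

lemma i_measurable: "i t \<in> M \<rightarrow>\<^sub>M count_space {1..n}"
  and i_uniform: "distr M (count_space {1..n}) (i t) = uniform_count_measure {1..n}"
  and indep: "indep_set (sets (vimage_algebra (space M) (i t) (count_space {1..n})))
          (sets (vimage_algebra (space M) (x (d t)) borel))"
  using run t by (auto simp: dap_sgd_run_def)

lemma x_Suc: "\<omega> \<in> space M \<Longrightarrow> x (Suc t) \<omega> = x t \<omega>
    + (prox (\<eta> (d t)) h (x (d t) \<omega> - \<eta> (d t) *\<^sub>R gradient (fs (i t \<omega>)) (x (d t) \<omega>)) - x (d t) \<omega>)"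
  using run t by (auto simp: dap_sgd_run_def)

text \<open>Turns the additive delay into a multiplicative one, so that every rate in
  \<open>d t\<close> becomes a rate in \<open>t\<close> at the cost of a factor
  \<open>real \<tau> + 1\<close>.\<close>

lemma delay_Suc_le: "real t + 1 \<le> (real \<tau> + 1) * (real (d t) + 1)"
proof -
  have "real t \<le> real (d t) + real \<tau>" using d_ge by linarith
  moreover have "(real \<tau> + 1) * (real (d t) + 1) = real \<tau> * real (d t) + (real (d t) + real \<tau> + 1)"
    by (simp add: algebra_simps)
  moreover have "0 \<le> real \<tau> * real (d t)" by simp
  ultimately show ?thesis by linarith
qed

lemma step_delay_le: "\<eta> (d t) \<le> c * (real \<tau> + 1) / (real t + 1)"
proof -
  have "\<eta> (d t) \<le> c / (real (d t) + 1)" by (rule step_le)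
  also have "\<dots> = c * (real \<tau> + 1) / ((real \<tau> + 1) * (real (d t) + 1))" by simp
  also have "\<dots> \<le> c * (real \<tau> + 1) / (real t + 1)"
    using c_pos by (intro divide_left_mono delay_Suc_le) auto
  finally show ?thesis .
qed

lemma simple_i: "simple_function M (i t)"
proof -
  have *: "i t ` space M \<subseteq> {1..n}" using measurable_space[OF i_measurable] by auto
  moreover have "i t -` {k} \<inter> space M \<in> sets M" if "k \<in> i t ` space M" for k
    using measurable_sets[OF i_measurable, of "{k}"] * that by auto
  ultimately show ?thesis
    unfolding simple_function_def using finite_subset by blast
qed

end

text \<open>Strong induction, since an iterate depends on its predecessor and on an older iterate.
  Simple functions are closed under composition with arbitrary maps, so \<open>gradient\<close> and
  \<open>prox\<close> can be applied without a measurability argument.\<close>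

lemma simple_x: "s \<le> T \<Longrightarrow> simple_function M (x s)"
proof (induction s rule: less_induct)
  case (less s)
  show ?case
  proof (cases s)
    case 0
    have "simple_function M (\<lambda>_. x\<^sub>0)" by simp
    then show ?thesis using simple_function_cong[of M "x 0" "\<lambda>_. x\<^sub>0"] x_0 0 by simp
  next
    case (Suc t)
    then have t: "t < T" using less.prems by simp
    have "simple_function M (x t)" "simple_function M (x (d t))"
      using less.IH[of t] less.IH[of "d t"] Suc t d_le[OF t] by auto
    then have "simple_function M (\<lambda>\<omega>. (x t \<omega>, x (d t) \<omega>, i t \<omega>))"
      by (intro simple_function_Pair simple_i[OF t])
    then have "simple_function M (\<lambda>\<omega>. case (x t \<omega>, x (d t) \<omega>, i t \<omega>) of (z, y, k) \<Rightarrow>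
        z + (prox (\<eta> (d t)) h (y - \<eta> (d t) *\<^sub>R gradient (fs k) y) - y))"
      by (rule simple_function_compose1)
    then have step: "simple_function M (\<lambda>\<omega>. x t \<omega> + (prox (\<eta> (d t)) h
        (x (d t) \<omega> - \<eta> (d t) *\<^sub>R gradient (fs (i t \<omega>)) (x (d t) \<omega>)) - x (d t) \<omega>))"
      by (simp only: prod.case)
    show ?thesis
      unfolding Suc by (rule simple_function_cong[THEN iffD1, OF _ step]) (simp add: x_Suc[OF t])
  qed
qed

lemma integrable_iterates:
  fixes \<phi> :: "'a \<Rightarrow> 'a \<Rightarrow> real"
  assumes "s \<le> T" "r \<le> T"
  shows "integrable M (\<lambda>\<omega>. \<phi> (x s \<omega>) (x r \<omega>))"
  by (rule integrable_simple[OF simple_function_compose2[OF simple_x[OF assms(1)] simple_x[OF assms(2)]]])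

lemma integrable_sample_iterate:
  fixes \<phi> :: "nat \<Rightarrow> 'a \<Rightarrow> real"
  assumes "t < T"
  shows "integrable M (\<lambda>\<omega>. \<phi> (i t \<omega>) (x (d t) \<omega>))"
proof -
  have "d t \<le> T" using d_le[OF assms] assms by simp
  then show ?thesis
    by (rule integrable_simple[OF simple_function_compose2[OF simple_i[OF assms] simple_x]])
qed

definition msd :: "nat \<Rightarrow> real" where
  "msd t = expectation (\<lambda>\<omega>. (norm (x t \<omega> - xstar))\<^sup>2)"

lemma msd_nonneg: "msd t \<ge> 0"
  by (simp add: msd_def)

lemma msd_0: "msd 0 = (norm (x\<^sub>0 - xstar))\<^sup>2"
proof -
  have "msd 0 = expectation (\<lambda>_. (norm (x\<^sub>0 - xstar))\<^sup>2)"
    unfolding msd_def by (rule Bochner_Integration.integral_cong) (simp_all add: x_0)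
  then show ?thesis by (simp add: prob_space)
qed

context
  fixes t assumes t: "t < T"
begin

definition noise :: "'w \<Rightarrow> 'a" where
  "noise \<omega> = gradient (fs (i t \<omega>)) (x (d t) \<omega>) - gradient f (x (d t) \<omega>)"

text \<open>The noise is paired with the error of the outdated iterate, which is independent of the
  sample; the current iterate may already depend on it.\<close>

lemma expectation_noise_inner: "expectation (\<lambda>\<omega>. noise \<omega> \<bullet> (x (d t) \<omega> - xstar)) = 0"
proof -
  have "simple_function M (x (d t))" using simple_x d_le[OF t] t by simp
  then have "expectation (\<lambda>\<omega>. noise \<omega> \<bullet> (x (d t) \<omega> - xstar))
      = expectation (\<lambda>\<omega>. (\<Sum>k = 1..n. (gradient (fs k) (x (d t) \<omega>) - gradient f (x (d t) \<omega>))
          \<bullet> (x (d t) \<omega> - xstar)) / real n)"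
    unfolding noise_def
    using expectation_uniform_indep[OF n_pos i_measurable[OF t] i_uniform[OF t] _ indep[OF t],
      of "\<lambda>k y. (gradient (fs k) y - gradient f y) \<bullet> (y - xstar)"] by simp
  then show ?thesis by (simp only: inner_sum_left[symmetric] sum_gradient_deviation) simp
qed

lemma expectation_noise_squared: "expectation (\<lambda>\<omega>. (norm (noise \<omega>))\<^sup>2) \<le> C\<^sub>f"
proof -
  have s: "simple_function M (x (d t))" using simple_x d_le[OF t] t by simp
  have "expectation (\<lambda>\<omega>. (norm (noise \<omega>))\<^sup>2)
      = expectation (\<lambda>\<omega>. (\<Sum>k = 1..n. (norm (gradient (fs k) (x (d t) \<omega>)
          - gradient f (x (d t) \<omega>)))\<^sup>2) / real n)"
    unfolding noise_def
    using expectation_uniform_indep[OF n_pos i_measurable[OF t] i_uniform[OF t] s indep[OF t],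
      of "\<lambda>k y. (norm (gradient (fs k) y - gradient f y))\<^sup>2"] .
  also have "\<dots> \<le> C\<^sub>f"
    using integrable_iterates[of "d t" "d t" "\<lambda>y _. (\<Sum>k = 1..n. (norm (gradient (fs k) y
          - gradient f y))\<^sup>2) / real n"] d_le[OF t] t mean_squared_deviation
    by (intro integral_le_const) auto
  finally show ?thesis .
qed

text \<open>Noise contributes \<open>C\<^sub>f\<close>, the outdated error at most
  \<open>L\<^sup>2 * A\<close>, the subgradients \<open>4 * C\<^sub>h\<close>. Pulling out
  \<open>1 + A\<close> leaves a constant independent of the run.\<close>

lemma expectation_increment_squared:
  assumes A: "\<And>s. s \<le> t \<Longrightarrow> msd s \<le> A"
  shows "expectation (\<lambda>\<omega>. (norm (x (Suc t) \<omega> - x t \<omega>))\<^sup>2) \<le> K\<^sub>\<Delta> * (1 + A) / (real t + 1)\<^sup>2"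
proof -
  define e where "e = \<eta> (d t)"
  define b where "b = c * (real \<tau> + 1) / (real t + 1)"
  have e: "0 < e" "e \<le> b" using step_pos step_delay_le[OF t] by (auto simp: e_def b_def)
  have A_nonneg: "A \<ge> 0" using A[of 0] msd_nonneg[of 0] by simp
  have int: "integrable M (\<lambda>\<omega>. (norm (noise \<omega>))\<^sup>2)"
      "integrable M (\<lambda>\<omega>. (norm (x (d t) \<omega> - xstar))\<^sup>2)"
      "integrable M (\<lambda>\<omega>. (norm (x (Suc t) \<omega> - x t \<omega>))\<^sup>2)"
    using integrable_sample_iterate[OF t, of "\<lambda>k y. (norm (gradient (fs k) y - gradient f y))\<^sup>2"]
      integrable_iterates[of "d t" "d t" "\<lambda>y _. (norm (y - xstar))\<^sup>2"]
      integrable_iterates[of "Suc t" t "\<lambda>y z. (norm (y - z))\<^sup>2"] d_le[OF t] t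
    by (auto simp: noise_def)
  have "expectation (\<lambda>\<omega>. (norm (x (Suc t) \<omega> - x t \<omega>))\<^sup>2)
      \<le> expectation (\<lambda>\<omega>. 3 * e\<^sup>2 * ((norm (noise \<omega>))\<^sup>2 + L\<^sup>2 * (norm (x (d t) \<omega> - xstar))\<^sup>2 + 4 * C\<^sub>h))"
  proof (rule integral_mono)
    fix \<omega> assume "\<omega> \<in> space M"
    then show "(norm (x (Suc t) \<omega> - x t \<omega>))\<^sup>2
        \<le> 3 * e\<^sup>2 * ((norm (noise \<omega>))\<^sup>2 + L\<^sup>2 * (norm (x (d t) \<omega> - xstar))\<^sup>2 + 4 * C\<^sub>h)"
      using proximal_step_increment[OF e(1)] by (simp add: x_Suc[OF t] noise_def e_def)
  qed (use int in auto)
  also have "\<dots> = 3 * e\<^sup>2 * (expectation (\<lambda>\<omega>. (norm (noise \<omega>))\<^sup>2) + L\<^sup>2 * msd (d t) + 4 * C\<^sub>h)"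
    using int by (simp add: msd_def prob_space)
  also have "\<dots> \<le> 3 * b\<^sup>2 * ((C\<^sub>f + L\<^sup>2 + 4 * C\<^sub>h) * (1 + A))"
  proof (intro mult_mono)
    have "expectation (\<lambda>\<omega>. (norm (noise \<omega>))\<^sup>2) + L\<^sup>2 * msd (d t) + 4 * C\<^sub>h \<le> C\<^sub>f + L\<^sup>2 * A + 4 * C\<^sub>h"
      using expectation_noise_squared A[OF d_le[OF t]] by (intro add_mono mult_left_mono) auto
    also have "\<dots> \<le> (C\<^sub>f + L\<^sup>2 + 4 * C\<^sub>h) * (1 + A)"
      using mult_nonneg_nonneg[OF C\<^sub>f_nonneg A_nonneg] mult_nonneg_nonneg[OF C\<^sub>h_nonneg A_nonneg]
      by (simp add: algebra_simps)
    finally show "expectation (\<lambda>\<omega>. (norm (noise \<omega>))\<^sup>2) + L\<^sup>2 * msd (d t) + 4 * C\<^sub>h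
        \<le> (C\<^sub>f + L\<^sup>2 + 4 * C\<^sub>h) * (1 + A)" .
  qed (use e C\<^sub>h_nonneg msd_nonneg in \<open>auto intro!: power_mono add_nonneg_nonneg mult_nonneg_nonneg\<close>)
  also have "\<dots> = K\<^sub>\<Delta> * (1 + A) / (real t + 1)\<^sup>2"
    by (simp add: K\<^sub>\<Delta>_def b_def power_divide)
  finally show ?thesis .
qed

end

text \<open>The drift telescopes into at most \<tau> increments. One factor \<tau> comes from
  Cauchy-Schwarz, the other from the number of summands, and
  \<open>(real \<tau> + 1)\<^sup>2\<close> from comparing the earlier times with
  \<open>t\<close>.\<close>

lemma expectation_drift_squared:
  assumes t: "t < T" and A: "\<And>s. s \<le> t \<Longrightarrow> msd s \<le> A"
  shows "expectation (\<lambda>\<omega>. (norm (x t \<omega> - x (d t) \<omega>))\<^sup>2)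
    \<le> (real \<tau>)\<^sup>2 * (real \<tau> + 1)\<^sup>2 * K\<^sub>\<Delta> * (1 + A) / (real t + 1)\<^sup>2"
proof -
  define S where "S = {d t..<t}"
  define B where "B = (real \<tau> + 1)\<^sup>2 * K\<^sub>\<Delta> * (1 + A) / (real t + 1)\<^sup>2"
  have A_nonneg: "A \<ge> 0" using A[of 0] msd_nonneg[of 0] by simp
  have B: "B \<ge> 0" using K\<^sub>\<Delta>_nonneg A_nonneg by (simp add: B_def)
  have card: "real (card S) \<le> real \<tau>" using d_ge[OF t] by (simp add: S_def)
  have int: "integrable M (\<lambda>\<omega>. (norm (x (Suc s) \<omega> - x s \<omega>))\<^sup>2)" if "s \<in> S" for s
    using integrable_iterates[of "Suc s" s "\<lambda>y z. (norm (y - z))\<^sup>2"] that t by (simp add: S_def)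
  have "expectation (\<lambda>\<omega>. (norm (x t \<omega> - x (d t) \<omega>))\<^sup>2)
      \<le> expectation (\<lambda>\<omega>. real (card S) * (\<Sum>s\<in>S. (norm (x (Suc s) \<omega> - x s \<omega>))\<^sup>2))"
  proof (rule integral_mono)
    show "integrable M (\<lambda>\<omega>. (norm (x t \<omega> - x (d t) \<omega>))\<^sup>2)"
      using integrable_iterates[of t "d t" "\<lambda>y z. (norm (y - z))\<^sup>2"] t d_le[OF t] by simp
    show "integrable M (\<lambda>\<omega>. real (card S) * (\<Sum>s\<in>S. (norm (x (Suc s) \<omega> - x s \<omega>))\<^sup>2))"
      using int by auto
    show "(norm (x t \<omega> - x (d t) \<omega>))\<^sup>2 \<le> real (card S) * (\<Sum>s\<in>S. (norm (x (Suc s) \<omega> - x s \<omega>))\<^sup>2)" for \<omega>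
      using norm_sum_squared_le[of S "\<lambda>s. x (Suc s) \<omega> - x s \<omega>"]
        sum_Suc_diff'[OF d_le[OF t], of "\<lambda>s. x s \<omega>"] by (simp add: S_def)
  qed
  also have "\<dots> = real (card S) * (\<Sum>s\<in>S. expectation (\<lambda>\<omega>. (norm (x (Suc s) \<omega> - x s \<omega>))\<^sup>2))"
    using int by simp
  also have "\<dots> \<le> real (card S) * (\<Sum>s\<in>S. B)"
  proof (intro mult_left_mono sum_mono)
    fix s assume "s \<in> S"
    then have s: "d t \<le> s" "s < t" "s < T" using t by (auto simp: S_def)
    have "real t + 1 \<le> (real \<tau> + 1) * (real (d t) + 1)" by (rule delay_Suc_le[OF t])
    also have "\<dots> \<le> (real \<tau> + 1) * (real s + 1)" using s by (intro mult_left_mono) auto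
    finally have "(real t + 1)\<^sup>2 \<le> (real \<tau> + 1)\<^sup>2 * (real s + 1)\<^sup>2"
      unfolding power_mult_distrib[symmetric] by (intro power_mono) auto
    then have "1 / (real s + 1)\<^sup>2 \<le> (real \<tau> + 1)\<^sup>2 / (real t + 1)\<^sup>2" by (simp add: divide_simps)
    then have "K\<^sub>\<Delta> * (1 + A) * (1 / (real s + 1)\<^sup>2) \<le> K\<^sub>\<Delta> * (1 + A) * ((real \<tau> + 1)\<^sup>2 / (real t + 1)\<^sup>2)"
      using K\<^sub>\<Delta>_nonneg A_nonneg by (intro mult_left_mono) auto
    then have "K\<^sub>\<Delta> * (1 + A) / (real s + 1)\<^sup>2 \<le> B" by (simp add: B_def mult_ac)
    moreover have "expectation (\<lambda>\<omega>. (norm (x (Suc s) \<omega> - x s \<omega>))\<^sup>2) \<le> K\<^sub>\<Delta> * (1 + A) / (real s + 1)\<^sup>2"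
      using s A by (intro expectation_increment_squared) auto
    ultimately show "expectation (\<lambda>\<omega>. (norm (x (Suc s) \<omega> - x s \<omega>))\<^sup>2) \<le> B" by linarith
  qed simp
  also have "\<dots> \<le> real \<tau> * (real \<tau> * B)"
    using card B by (simp del: of_nat_diff) (intro mult_mono; simp)
  also have "\<dots> = (real \<tau>)\<^sup>2 * (real \<tau> + 1)\<^sup>2 * K\<^sub>\<Delta> * (1 + A) / (real t + 1)\<^sup>2"
    by (simp add: B_def power2_eq_square)
  finally show ?thesis .
qed

text \<open>The expectation of \<open>proximal_step_progress\<close>: the noise term vanishes, and
  everything except the contraction is of order
  \<open>(1 + A) / (real t + 1)\<^sup>2\<close>.\<close>

lemma msd_Suc_le:
  assumes t: "t < T" and A: "\<And>s. s \<le> t \<Longrightarrow> msd s \<le> A"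
  shows "msd (Suc t) \<le> (1 - 2 * \<mu> * \<eta> (d t)) * msd t + K * (1 + A) / (real t + 1)\<^sup>2"
proof -
  define e where "e = \<eta> (d t)"
  define b where "b = c * (real \<tau> + 1) / (real t + 1)"
  have e: "0 < e" "e \<le> b" using step_pos step_delay_le[OF t] by (auto simp: e_def b_def)
  have e_c: "e \<le> c"
  proof -
    have "c / (real (d t) + 1) \<le> c / 1" using c_pos by (intro divide_left_mono) auto
    then show ?thesis using step_le[of "d t"] by (simp add: e_def)
  qed
  have A_nonneg: "A \<ge> 0" using A[of 0] msd_nonneg[of 0] by simp
  have dT: "d t \<le> T" "t \<le> T" "Suc t \<le> T" using d_le[OF t] t by auto
  define F\<^sub>1 where "F\<^sub>1 \<omega> = (norm (x t \<omega> - xstar))\<^sup>2" for \<omega>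
  define F\<^sub>2 where "F\<^sub>2 \<omega> = noise t \<omega> \<bullet> (x (d t) \<omega> - xstar)" for \<omega>
  define F\<^sub>3 where "F\<^sub>3 \<omega> = (norm (x (Suc t) \<omega> - x t \<omega>))\<^sup>2" for \<omega>
  define F\<^sub>4 where "F\<^sub>4 \<omega> = (norm (x t \<omega> - x (d t) \<omega>))\<^sup>2" for \<omega>
  define F\<^sub>5 where "F\<^sub>5 \<omega> = (norm (x (d t) \<omega> - xstar))\<^sup>2" for \<omega>
  have int: "integrable M F\<^sub>1" "integrable M F\<^sub>2" "integrable M F\<^sub>3" "integrable M F\<^sub>4" "integrable M F\<^sub>5"
      "integrable M (\<lambda>\<omega>. (norm (x (Suc t) \<omega> - xstar))\<^sup>2)"
    unfolding F\<^sub>1_def F\<^sub>2_def F\<^sub>3_def F\<^sub>4_def F\<^sub>5_def noise_def[OF t]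
    using integrable_iterates[OF dT(2,2), of "\<lambda>y _. (norm (y - xstar))\<^sup>2"]
      integrable_sample_iterate[OF t, of "\<lambda>k y. (gradient (fs k) y - gradient f y) \<bullet> (y - xstar)"]
      integrable_iterates[OF dT(3,2), of "\<lambda>y z. (norm (y - z))\<^sup>2"]
      integrable_iterates[OF dT(2,1), of "\<lambda>y z. (norm (y - z))\<^sup>2"]
      integrable_iterates[OF dT(1,1), of "\<lambda>y _. (norm (y - xstar))\<^sup>2"]
      integrable_iterates[OF dT(3,3), of "\<lambda>y _. (norm (y - xstar))\<^sup>2"]
    by simp_all
  have "msd (Suc t) \<le> expectation (\<lambda>\<omega>. (1 - 2 * \<mu> * e) * F\<^sub>1 \<omega> - 2 * e * F\<^sub>2 \<omega> + 3 * F\<^sub>3 \<omega> + 4 * C\<^sub>h * e\<^sup>2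
      + (3 + 2 * \<mu> * e) * F\<^sub>4 \<omega> + 2 * (\<mu> * e)\<^sup>2 * F\<^sub>5 \<omega>)"
    unfolding msd_def
  proof (rule integral_mono)
    fix \<omega> assume \<omega>: "\<omega> \<in> space M"
    show "(norm (x (Suc t) \<omega> - xstar))\<^sup>2 \<le> (1 - 2 * \<mu> * e) * F\<^sub>1 \<omega> - 2 * e * F\<^sub>2 \<omega> + 3 * F\<^sub>3 \<omega>
        + 4 * C\<^sub>h * e\<^sup>2 + (3 + 2 * \<mu> * e) * F\<^sub>4 \<omega> + 2 * (\<mu> * e)\<^sup>2 * F\<^sub>5 \<omega>"
      using proximal_step_progress[OF e(1), of "x t \<omega>" "x (d t) \<omega>" "gradient (fs (i t \<omega>)) (x (d t) \<omega>)"]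
      by (simp add: F\<^sub>1_def F\<^sub>2_def F\<^sub>3_def F\<^sub>4_def F\<^sub>5_def noise_def[OF t] x_Suc[OF t \<omega>] e_def[symmetric])
  qed (use int in auto)
  also have "\<dots> = (1 - 2 * \<mu> * e) * msd t + (3 * expectation F\<^sub>3 + 4 * C\<^sub>h * e\<^sup>2
      + (3 + 2 * \<mu> * e) * expectation F\<^sub>4 + 2 * (\<mu> * e)\<^sup>2 * msd (d t))"
    using int expectation_noise_inner[OF t]
    by (simp add: prob_space F\<^sub>2_def[symmetric]) (simp add: F\<^sub>1_def[abs_def] F\<^sub>5_def[abs_def] msd_def)
  also have "\<dots> \<le> (1 - 2 * \<mu> * e) * msd t + K * (1 + A) / (real t + 1)\<^sup>2"
  proof -
    define r where "r = (1 + A) / (real t + 1)\<^sup>2"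
    define G where "G = (real \<tau>)\<^sup>2 * (real \<tau> + 1)\<^sup>2 * K\<^sub>\<Delta>"
    have 1: "expectation F\<^sub>3 \<le> K\<^sub>\<Delta> * r"
      using expectation_increment_squared[OF t A] by (simp add: F\<^sub>3_def[abs_def] r_def)
    have "expectation F\<^sub>4 \<le> G * r"
      using expectation_drift_squared[OF t A] by (simp add: F\<^sub>4_def[abs_def] r_def G_def)
    moreover have "G * r \<ge> 0" using K\<^sub>\<Delta>_nonneg A_nonneg by (simp add: G_def r_def)
    ultimately have 2: "(3 + 2 * \<mu> * e) * expectation F\<^sub>4 \<le> (3 + 2 * \<mu> * c) * (G * r)"
      using e e_c mu_pos c_pos by (intro mult_mono) (auto simp: F\<^sub>4_def)
    \<comment> \<open>The bound \<open>e2\<close> does not contain \<open>1 + A\<close>. For the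
      subgradient term this factor is inserted because it is at least 1; for the last term it comes
      from the bound on \<open>msd (d t)\<close>.\<close>
    have "e\<^sup>2 \<le> b\<^sup>2" using e by (intro power_mono) auto
    also have "\<dots> = (c * (real \<tau> + 1))\<^sup>2 * (1 / (real t + 1)\<^sup>2)" by (simp add: b_def power_divide)
    finally have e2: "e\<^sup>2 \<le> (c * (real \<tau> + 1))\<^sup>2 * (1 / (real t + 1)\<^sup>2)" .
    also have "\<dots> \<le> (c * (real \<tau> + 1))\<^sup>2 * r"
      unfolding r_def using A_nonneg by (intro mult_left_mono divide_right_mono) auto
    finally have 3: "4 * C\<^sub>h * e\<^sup>2 \<le> 4 * C\<^sub>h * ((c * (real \<tau> + 1))\<^sup>2 * r)"
      using C\<^sub>h_nonneg by (intro mult_left_mono) auto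
    have "e\<^sup>2 * msd (d t) \<le> (c * (real \<tau> + 1))\<^sup>2 * (1 / (real t + 1)\<^sup>2) * (1 + A)"
      using e2 A[OF d_le[OF t]] msd_nonneg by (intro mult_mono) auto
    then have "2 * \<mu>\<^sup>2 * (e\<^sup>2 * msd (d t)) \<le> 2 * \<mu>\<^sup>2 * ((c * (real \<tau> + 1))\<^sup>2 * r)"
      by (intro mult_left_mono) (auto simp: r_def)
    then have 4: "2 * (\<mu> * e)\<^sup>2 * msd (d t) \<le> 2 * (\<mu> * (c * (real \<tau> + 1)))\<^sup>2 * r"
      by (simp only: power_mult_distrib mult.assoc)
    have "K * (1 + A) / (real t + 1)\<^sup>2 = K * r" by (simp add: r_def)
    also have "\<dots> = 3 * (K\<^sub>\<Delta> * r) + 4 * C\<^sub>h * ((c * (real \<tau> + 1))\<^sup>2 * r)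
        + (3 + 2 * \<mu> * c) * (G * r) + 2 * (\<mu> * (c * (real \<tau> + 1)))\<^sup>2 * r"
      unfolding K_def G_def[symmetric] by (simp only: distrib_right mult.assoc)
    finally show ?thesis using 1 2 3 4 by linarith
  qed
  finally show ?thesis by (simp add: e_def)
qed

text \<open>The contraction is discarded: its factor is at most 1 and multiplies a nonnegative
  quantity, even while early steps may make the factor negative.\<close>

lemma msd_bounded:
  assumes "t \<le> T"
  shows "msd t \<le> (1 + (norm (x\<^sub>0 - xstar))\<^sup>2) * exp (2 * K)"
proof -
  have "msd t \<le> (1 + msd 0) * exp (2 * K)"
  proof (rule perturbed_growth_bounded[OF K_nonneg msd_nonneg _ assms])
    fix s A assume s: "s < T" and A: "\<And>r. r \<le> s \<Longrightarrow> msd r \<le> A"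
    have "(1 - 2 * \<mu> * \<eta> (d s)) * msd s \<le> 1 * msd s"
      using mu_pos step_pos[of "d s"] msd_nonneg by (intro mult_right_mono) auto
    then show "msd (Suc s) \<le> msd s + K * (1 + A) / (real s + 1)\<^sup>2"
      using msd_Suc_le[OF s A] by linarith
  qed
  then show ?thesis by (simp add: msd_0)
qed

text \<open>From \<open>t\<^sub>0\<close> on, the offset \<open>N + \<tau>\<close> places even the
  outdated index beyond \<open>N\<close>, where the lower bound on the step-size holds; the
  remaining 3 keeps that index positive and meets the threshold of \<open>log_decay\<close>.\<close>

lemma msd_log_decay:
  assumes lower: "\<And>t. N \<le> t \<Longrightarrow> \<eta> t \<ge> 1 / (2 * \<mu> * real t)"
    and W: "W = (1 + (norm (x\<^sub>0 - xstar))\<^sup>2) * exp (2 * K)"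
    and t0: "t\<^sub>0 = N + \<tau> + 3" and T: "t\<^sub>0 \<le> T"
  shows "msd T \<le> 2 * (real t\<^sub>0 * W + 2 * (K * (1 + W))) * (ln (real T) / real T)"
proof (rule log_decay)
  have W_nonneg: "W \<ge> 0" by (simp add: W)
  then show "W \<ge> 0" "K * (1 + W) \<ge> 0" using K_nonneg by auto
  show "msd t\<^sub>0 \<le> W" using msd_bounded[OF T] W by simp
  show "t\<^sub>0 \<ge> 3" "t\<^sub>0 \<le> T" using t0 T by auto
  fix t assume t: "t\<^sub>0 \<le> t" "t < T"
  have d: "N \<le> d t" "d t > 0" "d t \<le> t" using d_ge[OF t(2)] d_le[OF t(2)] t(1) t0 by auto
  \<comment> \<open>For the lower bound on the step-size the delay is harmless: an older index gives
    a larger lower bound.\<close>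
  have "1 / real t \<le> 1 / real (d t)" using d by (intro divide_left_mono) auto
  also have "\<dots> \<le> 2 * \<mu> * \<eta> (d t)" using lower[OF d(1)] mu_pos d by (simp add: field_simps)
  finally have 1: "(1 - 2 * \<mu> * \<eta> (d t)) * msd t \<le> (1 - 1 / real t) * msd t"
    using msd_nonneg by (intro mult_right_mono) auto
  have "K * (1 + W) / (real t + 1)\<^sup>2 \<le> K * (1 + W) / (real t)\<^sup>2"
    using K_nonneg W_nonneg t t0 by (intro divide_left_mono power_mono) auto
  then show "msd (Suc t) \<le> (1 - 1 / real t) * msd t + K * (1 + W) / (real t)\<^sup>2"
    using msd_Suc_le[OF t(2), of W] msd_bounded t 1 by (simp add: W)
qed

end

section \<open>From step-size asymptotics to a rate uniform over all runs\<close>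

lemma inverse_step_bound:
  fixes \<eta> :: "nat \<Rightarrow> real"
  assumes "\<eta> \<in> O(\<lambda>t. 1 / real t)"
  obtains c where "\<And>t. \<eta> t \<le> c / (real t + 1)"
proof -
  obtain C where C: "C > 0" "eventually (\<lambda>t. norm (\<eta> t) \<le> C * norm (1 / real t)) sequentially"
    using landau_o.bigE[OF assms] by blast
  then obtain N where N: "\<And>t. t \<ge> N \<Longrightarrow> \<bar>\<eta> t\<bar> \<le> C * (1 / real t)"
    by (auto simp: eventually_sequentially)
  \<comment> \<open>The value \<open>2 * C\<close> turns C/t into a multiple of 1/(t + 1) beyond
    \<open>N\<close>; the finite maximum covers the earlier times, including time 0.\<close>
  define D where "D = Max (insert (2 * C) ((\<lambda>t. \<eta> t * (real t + 1)) ` {..N}))"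
  have "\<eta> t \<le> D / (real t + 1)" for t
  proof (cases "t \<le> N")
    case True
    then have "\<eta> t * (real t + 1) \<le> D" unfolding D_def by (intro Max_ge) auto
    then show ?thesis by (simp add: pos_le_divide_eq)
  next
    case False
    have "2 * C \<le> D" unfolding D_def by (intro Max_ge) auto
    then have "2 * C / (real t + 1) \<le> D / (real t + 1)" by (intro divide_right_mono) auto
    moreover have "C * (1 / real t) \<le> 2 * C / (real t + 1)" using False C(1) by (simp add: field_simps)
    ultimately show ?thesis using N[of t] False by simp
  qed
  then show ?thesis using that by blast
qed

text \<open>\<open>B\<close> is chosen before the horizon, the probability space and the run, so the
  rate is uniform over them. The lower bound on the step-size makes the contraction factor at most 1
  - 1/t for large t; a factor 1 - a/t with a < 1 in the same recursion would give only the order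
  T^(-a).\<close>

theorem theorem1:
  fixes fs :: "nat \<Rightarrow> real ^ 'm \<Rightarrow> real"
    and f h :: "real ^ 'm \<Rightarrow> real"
    and n \<tau> :: nat
    and \<mu> L C\<^sub>f C\<^sub>h :: real
    and \<eta> :: "nat \<Rightarrow> real"
    and x\<^sub>0 xstar :: "real ^ 'm"
  assumes n_pos: "n \<ge> 1"
    and f_eq: "f = (\<lambda>x. 1 / real n * (\<Sum>k = 1..n. fs k x))"
    and fs_diff: "\<And>k x. k \<in> {1..n} \<Longrightarrow> fs k differentiable (at x)"
    and mu_pos: "\<mu> > 0"
    and f_strong: "strongly_convex \<mu> f"
    and h_convex: "convex_on UNIV h"
    and f_diff: "\<And>x. f differentiable (at x)"
    and f_lipschitz: "L-lipschitz_on UNIV (gradient f)"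
    and variance: "\<And>x. (\<integral>k. (norm (gradient (fs k) x - gradient f x))\<^sup>2
                         \<partial>uniform_count_measure {1..n}) \<le> C\<^sub>f"
    and subgrad: "\<And>x g. g \<in> subdifferential h x \<Longrightarrow> (norm g)\<^sup>2 \<le> C\<^sub>h"
    and optimal: "is_arg_min (\<lambda>x. f x + h x) (\<lambda>_. True) xstar"
    and step_pos: "\<And>t. \<eta> t > 0"
    and step_upper: "\<eta> \<in> O(\<lambda>t. 1 / real t)"
    and step_lower: "eventually (\<lambda>t. \<eta> t \<ge> 1 / (2 * \<mu> * real t)) sequentially"
  shows "\<exists>B. B \<in> O(\<lambda>T. ln (real T) / real T) \<and>
           (\<forall>T (M :: 'w measure) d i x.
              dap_sgd_run n fs h \<eta> \<tau> x\<^sub>0 T M d i x \<longrightarrow>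
              (\<integral>\<omega>. (norm (x T \<omega> - xstar))\<^sup>2 \<partial>M) \<le> B T)"
proof -
  obtain c where c: "\<And>t. \<eta> t \<le> c / (real t + 1)"
    using inverse_step_bound[OF step_upper] by blast
  obtain N where N: "\<And>t. N \<le> t \<Longrightarrow> \<eta> t \<ge> 1 / (2 * \<mu> * real t)"
    using step_lower by (auto simp: eventually_sequentially)
  interpret dap_problem f h \<mu> L C\<^sub>h xstar fs n \<tau> C\<^sub>f c \<eta> x\<^sub>0
    using assms c by unfold_locales
  define W where "W = (1 + (norm (x\<^sub>0 - xstar))\<^sup>2) * exp (2 * K)"
  define t\<^sub>0 where "t\<^sub>0 = N + \<tau> + 3"
  define D where "D = 2 * (real t\<^sub>0 * W + 2 * (K * (1 + W)))"
  define B where "B T = (if T < t\<^sub>0 then W else D * (ln (real T) / real T))" for T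
  have "B \<in> O(\<lambda>T. ln (real T) / real T)"
  proof (rule landau_o.bigI[of "\<bar>D\<bar> + 1"])
    have "norm (B T) \<le> (\<bar>D\<bar> + 1) * norm (ln (real T) / real T)" if "T \<ge> t\<^sub>0" for T
      using that by (simp add: B_def abs_mult mult_right_mono divide_right_mono)
    then show "eventually (\<lambda>T. norm (B T) \<le> (\<bar>D\<bar> + 1) * norm (ln (real T) / real T)) sequentially"
      unfolding eventually_sequentially by blast
  qed simp
  moreover have "(\<integral>\<omega>. (norm (x T \<omega> - xstar))\<^sup>2 \<partial>M) \<le> B T"
    if run: "dap_sgd_run n fs h \<eta> \<tau> x\<^sub>0 T M d i x" for T and M :: "'w measure" and d i x
  proof -
    interpret prob_space M using run by (simp add: dap_sgd_run_def)
    interpret dap_sgd f h \<mu> L C\<^sub>h xstar fs n \<tau> C\<^sub>f c \<eta> x\<^sub>0 M T d i x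
      using run by unfold_locales
    have "msd T \<le> B T"
      using msd_bounded[of T] msd_log_decay[OF N W_def t\<^sub>0_def] by (simp add: B_def W_def D_def)
    then show ?thesis by (simp add: msd_def)
  qed
  ultimately show ?thesis by blast
qed

end
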